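(* Let $C(t)$ be the covariance function of the stationary switch process with switching time distribution $F$, let $E(t)$ be the expected value function of the switch process with the same switching time distribution, and let $\mu$ be the expected value of the switching time distribution. Then for $t\ge 0$ $$C'(t)=-\frac{2}{\mu}E(t),$$ where the derivative at $t=0$ is the right-hand derivative.
   Context: Switch process: let $(T_k)_{k\ge 1}$ be i.i.d. non-negative random variables with distribution function $F$ (the switching time distribution), where $F$ is absolutely continuous with respect to Lebesgue measure with a density $f_T$ that is bounded on any closed interval of the positive half-line, and $F(0)=0$. Define $N(t)=\sup\{n\in\mathbb{N}:\sum_{k=1}^n T_k\le t\}$ for $t\ge T_1$ and $N(t)=0$ for $0\le t<T_1$. The switch process is $X(t)=(-1)^{N(t)}$, $t\ge 0$, and $E(t)=\mathbb{E}[X(t)]$. Stationary switch process: let $\mu=\mathbb{E}[T_1]$ (finite). Let $X_+,X_-$ be two independent switch processes with switching time distribution $F$. Let $(A,B)$ be a pair of non-negative random variables with joint density $f_{A,B}(a,b)=f_T(a+b)/\mu$ (so that $f_A(t)=f_B(t)=(1-F(t))/\mu$) and let $\delta$ satisfy $P(\delta=1)=P(\delta=-1)=1/2$, with $(A,B)$, $\delta$, $X_+$, $X_-$ mutually independent. Define, for $t\in\mathbb{R}$, $Y(t)=-\delta$ if $-B<t<A$; $Y(t)=\delta X_+(t-A)$ if $t\ge A$; $Y(t)=-\delta X_-(-(t+B))$ if $t\le -B$. The process $Y$ is the stationary switch process, and $C(t)=\mathrm{Cov}(Y(t),Y(0))=\mathbb{E}[Y(t)Y(0)]$. *)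

theory Defs
  imports "HOL-Probability.Probability"
begin

text \<open>
  The switching time distribution is represented by its law \<open>F\<close>, a measure on the real line;
  its distribution function is \<open>cdf F\<close>.  The density is only required to be bounded on
  compact subintervals of the open half-line, so it may be unbounded near 0.
\<close>

definition switching_time_distribution :: "real measure \<Rightarrow> (real \<Rightarrow> real) \<Rightarrow> bool" where
  "switching_time_distribution F f \<longleftrightarrow>
     prob_space F \<and>
     f \<in> borel_measurable borel \<and> (\<forall>x. 0 \<le> f x) \<and>
     F = density lborel (\<lambda>x. ennreal (f x)) \<and>
     (\<forall>a b. 0 < a \<longrightarrow> bounded (f ` {a..b})) \<and>
     cdf F 0 = 0"

definition switching_times :: "'a measure \<Rightarrow> real measure \<Rightarrow> (nat \<Rightarrow> 'a \<Rightarrow> real) \<Rightarrow> bool" where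
  "switching_times M F T \<longleftrightarrow>
     prob_space M \<and>
     prob_space.indep_vars M (\<lambda>_. borel) T {1..} \<and>
     (\<forall>k\<ge>1. distr M borel (T k) = F) \<and>
     (\<forall>k\<ge>1. AE \<omega> in M. 0 \<le> T k \<omega>)"

text \<open>
  The supremum is taken in \<^typ>\<open>nat\<close>.  The set is infinite only on a null event, where the
  value is irrelevant.
\<close>

definition switch_count :: "(nat \<Rightarrow> 'a \<Rightarrow> real) \<Rightarrow> real \<Rightarrow> 'a \<Rightarrow> nat" where
  "switch_count T t \<omega> = (if t < T 1 \<omega> then 0 else Sup {n. (\<Sum>k=1..n. T k \<omega>) \<le> t})"

definition switch_process :: "'a measure \<Rightarrow> real measure \<Rightarrow> (real \<Rightarrow> 'a \<Rightarrow> real) \<Rightarrow> bool" where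
  "switch_process M F X \<longleftrightarrow>
     (\<exists>T. switching_times M F T \<and>
       (\<forall>t\<ge>0. \<forall>\<omega>\<in>space M. X t \<omega> = (- 1) ^ switch_count T t \<omega>))"

definition process_path :: "(real \<Rightarrow> 'a \<Rightarrow> real) \<Rightarrow> 'a \<Rightarrow> real \<Rightarrow> real" where
  "process_path X \<omega> = (\<lambda>t\<in>{0..}. X t \<omega>)"

text \<open>
  The random elements below take values in different types, so \<open>indep_vars\<close> does not apply;
  their mutual independence is that of the generated sigma-algebras.  The processes generate
  the sigma-algebras of their finite-dimensional events, via the product sigma-algebra.
\<close>

definition stationary_components_indep ::
  "'a measure \<Rightarrow> ('a \<Rightarrow> real) \<Rightarrow> ('a \<Rightarrow> real) \<Rightarrow> ('a \<Rightarrow> real) \<Rightarrow>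
   (real \<Rightarrow> 'a \<Rightarrow> real) \<Rightarrow> (real \<Rightarrow> 'a \<Rightarrow> real) \<Rightarrow> bool" where
  "stationary_components_indep M A B \<delta> Xp Xm \<longleftrightarrow>
     prob_space.indep_sets M
       (\<lambda>i. [sets (vimage_algebra (space M) (\<lambda>\<omega>. (A \<omega>, B \<omega>)) (borel \<Otimes>\<^sub>M borel)),
             sets (vimage_algebra (space M) \<delta> borel),
             sets (vimage_algebra (space M) (process_path Xp) (Pi\<^sub>M {0..} (\<lambda>_. borel))),
             sets (vimage_algebra (space M) (process_path Xm) (Pi\<^sub>M {0..} (\<lambda>_. borel)))] ! i)
       {..<4}"

text \<open>
  The joint density \<open>f (a + b) / \<mu>\<close> of \<open>(A, B)\<close> is supported on the non-negative quadrant;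
  the explicit restriction is needed because \<open>a + b\<close> can be positive outside it.  The final
  branch of the path definition is the case \<open>t \<le> - B\<close>; for non-negative \<open>A\<close> and \<open>B\<close> it overlaps
  \<open>A \<le> t\<close> only if \<open>A = B = t = 0\<close>, a null event.
\<close>

definition stationary_switch_process ::
  "'a measure \<Rightarrow> real measure \<Rightarrow> (real \<Rightarrow> real) \<Rightarrow> (real \<Rightarrow> 'a \<Rightarrow> real) \<Rightarrow> bool" where
  "stationary_switch_process M F f Y \<longleftrightarrow>
     (\<exists>A B \<delta> Xp Xm.
        switch_process M F Xp \<and> switch_process M F Xm \<and>
        distributed M (lborel \<Otimes>\<^sub>M lborel) (\<lambda>\<omega>. (A \<omega>, B \<omega>))
          (\<lambda>(a, b). ennreal (if 0 \<le> a \<and> 0 \<le> b then f (a + b) / (\<integral>x. x \<partial>F) else 0)) \<and>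
        (AE \<omega> in M. 0 \<le> A \<omega> \<and> 0 \<le> B \<omega>) \<and>
        \<delta> \<in> borel_measurable M \<and>
        measure M {\<omega> \<in> space M. \<delta> \<omega> = 1} = 1 / 2 \<and>
        measure M {\<omega> \<in> space M. \<delta> \<omega> = - 1} = 1 / 2 \<and>
        stationary_components_indep M A B \<delta> Xp Xm \<and>
        (\<forall>t. \<forall>\<omega>\<in>space M. Y t \<omega> =
           (if - B \<omega> < t \<and> t < A \<omega> then - \<delta> \<omega>
            else if A \<omega> \<le> t then \<delta> \<omega> * Xp (t - A \<omega>) \<omega>
            else - \<delta> \<omega> * Xm (- (t + B \<omega>)) \<omega>)))"

definition covariance :: "'a measure \<Rightarrow> ('a \<Rightarrow> real) \<Rightarrow> ('a \<Rightarrow> real) \<Rightarrow> real" where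
  "covariance M U V = (\<integral>\<omega>. (U \<omega> - (\<integral>x. U x \<partial>M)) * (V \<omega> - (\<integral>x. V x \<partial>M)) \<partial>M)"

end

theory Submission
  imports Defs
begin

text \<open>
  Let \<open>G\<^sub>n\<close> be the distribution function of the \<open>n\<close>-th switching epoch, i.e. of the \<open>n\<close>-fold
  convolution of \<open>F\<close>, and \<open>e = (\<Sum>n. (- 1) ^ n * (G\<^sub>n - G\<^sub>n\<^sub>+\<^sub>1))\<close>, which is the expected value function.
  The Markov bound \<open>G\<^sub>n t \<le> exp t * \<phi> ^ n\<close>, with \<open>\<phi> < 1\<close> the Laplace transform of \<open>F\<close> at 1, makes
  the series converge locally uniformly, so \<open>e\<close> is continuous on \<open>[0, \<infinity>)\<close>, and shifting the
  index gives the renewal equation \<open>e = 1 - F - e * F\<close> (Stieltjes convolution).  Almost surely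
  \<open>Y t * Y 0\<close> is 1 on \<open>t < A\<close> and \<open>- X\<^sub>+ (t - A)\<close> otherwise; since \<open>A\<close> has density \<open>(1 - F) / \<mu>\<close>,
  \<open>C t = 1 - (1 / \<mu>) * (\<integral>a = 0..t. (1 - F a) * (1 + e (t - a)))\<close>.  Integrating the renewal equation over
  \<open>[0, t]\<close> turns the integral into \<open>2 * (\<integral>s = 0..t. e s)\<close>, and the claim is the fundamental
  theorem of calculus.
\<close>

section \<open>Renewal laws\<close>

primrec renewal_law :: "real measure \<Rightarrow> nat \<Rightarrow> real measure" where
  "renewal_law F 0 = return borel 0"
| "renewal_law F (Suc n) = convolution F (renewal_law F n)"

declare renewal_law.simps [simp del]

text \<open>For \<open>t\<close> \<ge> 0, term \<open>n\<close> is \<open>(- 1) ^ n\<close> times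
  the probability of exactly \<open>n\<close> switches by time \<open>t\<close>. The formula
  involves \<open>F\<close> alone, so it links processes living on different probability
  spaces.\<close>

definition switch_mean :: "real measure \<Rightarrow> real \<Rightarrow> real" where
  "switch_mean F t = (\<Sum>n. (- 1) ^ n * (cdf (renewal_law F n) t - cdf (renewal_law F (Suc n)) t))"

locale switching_law =
  fixes F :: "real measure" and f :: "real \<Rightarrow> real"
  assumes switching: "switching_time_distribution F f"
begin

lemma law_density: "F = density lborel (\<lambda>x. ennreal (f x))"
  and density_measurable [measurable]: "f \<in> borel_measurable borel"
  and density_nonneg: "0 \<le> f x"
  using switching by (auto simp: switching_time_distribution_def)

sublocale prob_space F
  using switching unfolding switching_time_distribution_def by blast

lemma sets_law [simp, measurable_cong]: "sets F = sets borel"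
  by (subst law_density) simp

lemma space_law [simp]: "space F = UNIV"
  using sets_eq_imp_space_eq[OF sets_law] by simp

lemma law_UNIV [simp]: "prob UNIV = 1"
  using prob_space by simp

sublocale real_distribution F
  by unfold_locales simp

lemma law_pos: "AE x in F. 0 < x"
proof -
  have "prob {..0} = 0"
    using switching unfolding switching_time_distribution_def cdf_def by blast
  then have "{..0} \<in> null_sets F"
    by (simp add: null_sets_def emeasure_eq_measure)
  then show ?thesis
    by (rule AE_I') auto
qed

lemma law_singleton: "emeasure F {x} = 0"
proof -
  have "AE y in lborel. y \<in> {x} \<longrightarrow> ennreal (f y) \<le> 0"
    using AE_lborel_singleton[of x] by eventually_elim auto
  then show ?thesis
    by (subst law_density, subst emeasure_density) (auto simp: nn_integral_0_iff_AE split: split_indicator)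
qed

section \<open>Convolution powers and their distribution functions\<close>

lemma sets_renewal_law [simp, measurable_cong]: "sets (renewal_law F n) = sets borel"
  by (cases n) (auto simp: renewal_law.simps)

lemma space_renewal_law [simp]: "space (renewal_law F n) = UNIV"
  using sets_eq_imp_space_eq[OF sets_renewal_law] by simp

lemma prob_space_renewal_law: "prob_space (renewal_law F n)"
proof (induction n)
  case (Suc n)
  then interpret L: prob_space "renewal_law F n" .
  interpret pair_prob_space F "renewal_law F n" ..
  show ?case
    unfolding renewal_law.simps convolution_def by (rule prob_space_distr) measurable
qed (simp add: renewal_law.simps prob_space_return)

lemma real_distribution_renewal_law: "real_distribution (renewal_law F n)"
  using prob_space_renewal_law by (simp add: real_distribution_def real_distribution_axioms_def)

lemma nn_integral_renewal_law_Suc: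
  assumes [measurable]: "g \<in> borel_measurable borel"
  shows "(\<integral>\<^sup>+x. g x \<partial>renewal_law F (Suc n)) = (\<integral>\<^sup>+x. \<integral>\<^sup>+y. g (x + y) \<partial>renewal_law F n \<partial>F)"
proof -
  interpret L: prob_space "renewal_law F n" by (rule prob_space_renewal_law)
  show ?thesis
    unfolding renewal_law.simps by (rule nn_integral_convolution) (auto intro: L.finite_measure_axioms finite_measure_axioms)
qed

lemma emeasure_renewal_law_Suc:
  assumes "B \<in> sets borel"
  shows "emeasure (renewal_law F (Suc n)) B = (\<integral>\<^sup>+x. emeasure (renewal_law F n) {y. y + x \<in> B} \<partial>F)"
proof -
  interpret L: prob_space "renewal_law F n" by (rule prob_space_renewal_law)
  show ?thesis
    unfolding renewal_law.simps using assms
    by (intro convolution_emeasure) (auto intro: L.finite_measure_axioms finite_measure_axioms)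
qed

lemma borel_measurable_renewal_cdf [measurable]: "cdf (renewal_law F n) \<in> borel_measurable borel"
proof -
  interpret L: real_distribution "renewal_law F n" by (rule real_distribution_renewal_law)
  show ?thesis by (intro borel_measurable_mono monoI L.cdf_nondecreasing)
qed

lemma renewal_cdf_bounds: "0 \<le> cdf (renewal_law F n) t" "cdf (renewal_law F n) t \<le> 1"
proof -
  interpret L: real_distribution "renewal_law F n" by (rule real_distribution_renewal_law)
  show "0 \<le> cdf (renewal_law F n) t" "cdf (renewal_law F n) t \<le> 1"
    by (auto simp: cdf_def L.measure_le_1)
qed

lemma renewal_cdf_0: "cdf (renewal_law F 0) t = indicator {0..} t"
  by (auto simp: cdf_def renewal_law.simps measure_return split: split_indicator)

lemma renewal_cdf_Suc: "cdf (renewal_law F (Suc n)) t = (\<integral>u. cdf (renewal_law F n) (t - u) \<partial>F)"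
proof -
  interpret L: real_distribution "renewal_law F n" by (rule real_distribution_renewal_law)
  interpret L': real_distribution "renewal_law F (Suc n)" by (rule real_distribution_renewal_law)
  have "ennreal (cdf (renewal_law F (Suc n)) t) = (\<integral>\<^sup>+u. emeasure (renewal_law F n) {..t - u} \<partial>F)"
    unfolding cdf_def L'.emeasure_eq_measure[symmetric]
    by (subst emeasure_renewal_law_Suc) (auto intro!: nn_integral_cong arg_cong2[where f=emeasure])
  also have "\<dots> = (\<integral>\<^sup>+u. ennreal (cdf (renewal_law F n) (t - u)) \<partial>F)"
    by (simp add: cdf_def L.emeasure_eq_measure)
  finally have *: "(\<integral>\<^sup>+u. ennreal (cdf (renewal_law F n) (t - u)) \<partial>F) = ennreal (cdf (renewal_law F (Suc n)) t)" ..
  show ?thesis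
    by (subst integral_eq_nn_integral) (auto simp: renewal_cdf_bounds *)
qed

lemma renewal_cdf_1: "cdf (renewal_law F (Suc 0)) = cdf F"
proof
  fix t
  have "cdf (renewal_law F (Suc 0)) t = (\<integral>u. indicator {..t} u \<partial>F)"
    unfolding renewal_cdf_Suc renewal_cdf_0
    by (intro Bochner_Integration.integral_cong) (auto split: split_indicator)
  then show "cdf (renewal_law F (Suc 0)) t = cdf F t"
    by (simp add: cdf_def)
qed

lemma renewal_cdf_neg:
  assumes "t < 0"
  shows "cdf (renewal_law F n) t = 0"
  using assms
proof (induction n arbitrary: t)
  case (Suc n)
  have "(\<integral>u. cdf (renewal_law F n) (t - u) \<partial>F) = (\<integral>u. 0 \<partial>F)"
    using law_pos Suc by (intro integral_cong_AE) auto
  then show ?case by (simp only: renewal_cdf_Suc) simp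
qed (simp add: renewal_cdf_0)

text \<open>A further switching time is positive almost surely, so it can only delay the epoch:
  \<open>t - u\<close> lies below \<open>t\<close> for \<open>F\<close>-almost every
  \<open>u\<close>.\<close>

lemma renewal_cdf_Suc_le: "cdf (renewal_law F (Suc n)) t \<le> cdf (renewal_law F n) t"
proof -
  interpret L: real_distribution "renewal_law F n" by (rule real_distribution_renewal_law)
  have "(\<integral>u. cdf (renewal_law F n) (t - u) \<partial>F) \<le> (\<integral>u. cdf (renewal_law F n) t \<partial>F)"
  proof (rule integral_mono_AE)
    show "integrable F (\<lambda>u. cdf (renewal_law F n) (t - u))"
      by (rule integrable_const_bound[of _ 1]) (auto simp: renewal_cdf_bounds)
    show "AE u in F. cdf (renewal_law F n) (t - u) \<le> cdf (renewal_law F n) t"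
      using law_pos by eventually_elim (auto intro: L.cdf_nondecreasing)
  qed auto
  then show ?thesis by (simp add: renewal_cdf_Suc)
qed

text \<open>Convolving with \<open>F\<close> averages the masses of shifted singletons, and the
  induction starts from \<open>F\<close>, which has no atoms. The index \<open>Suc n\<close> leaves
  out the point mass at 0.\<close>

lemma renewal_law_singleton: "emeasure (renewal_law F (Suc n)) {x} = 0"
proof (induction n arbitrary: x)
  case 0
  have "emeasure (renewal_law F 1) {x} = (\<integral>\<^sup>+u. indicator {x} u \<partial>F)"
    unfolding One_nat_def
    by (subst emeasure_renewal_law_Suc, simp, intro nn_integral_cong)
       (auto simp: renewal_law.simps split: split_indicator)
  then show ?case by (simp add: law_singleton)
next
  case (Suc n)
  have "emeasure (renewal_law F (Suc (Suc n))) {x} = (\<integral>\<^sup>+u. emeasure (renewal_law F (Suc n)) {x - u} \<partial>F)"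
    by (subst emeasure_renewal_law_Suc) (auto intro!: nn_integral_cong arg_cong2[where f=emeasure])
  then show ?case by (simp add: Suc)
qed

text \<open>From the first epoch on there are no atoms; epoch 0 has one at 0, and restricting to the
  closed half-line hides its jump.\<close>

lemma continuous_on_renewal_cdf: "continuous_on {0..} (cdf (renewal_law F n))"
proof (cases n)
  case 0
  have "continuous_on {0..} (\<lambda>_::real. 1::real)" by simp
  then show ?thesis
    unfolding 0 by (rule continuous_on_eq) (simp add: renewal_cdf_0)
next
  case (Suc m)
  interpret L: real_distribution "renewal_law F n" by (rule real_distribution_renewal_law)
  have "isCont (cdf (renewal_law F n)) x" for x
    using renewal_law_singleton[of m x] unfolding L.isCont_cdf by (simp add: measure_def Suc)
  then show ?thesis by (simp add: continuous_at_imp_continuous_on)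
qed

section \<open>Geometric decay in the number of switches\<close>

definition laplace :: real where
  "laplace = (\<integral>x. exp (- x) \<partial>F)"

lemma integrable_exp: "integrable F (\<lambda>x. exp (- x))"
  using law_pos by (intro integrable_const_bound[of _ 1]) auto

lemma laplace_nonneg: "0 \<le> laplace"
  by (simp add: laplace_def)

text \<open>\<open>F\<close> has no mass at or below 0, so \<open>exp (- x)\<close> is strictly
  below 1 almost surely. The strictness makes the geometric series below converge.\<close>

lemma laplace_less_1: "laplace < 1"
proof -
  have "(\<integral>x. exp (- x) \<partial>F) < (\<integral>x. 1 \<partial>F)"
  proof (rule integral_less_AE_space)
    show "AE x in F. exp (- x) < 1" using law_pos by eventually_elim simp
  qed (auto simp: integrable_exp emeasure_space_1[simplified])
  then show ?thesis by (simp add: laplace_def)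
qed

text \<open>\<open>exp (- (x + y))\<close> factors, so the transform turns convolutions into
  products.\<close>

lemma nn_integral_exp_renewal_law: "(\<integral>\<^sup>+x. ennreal (exp (- x)) \<partial>renewal_law F n) = ennreal (laplace ^ n)"
proof (induction n)
  case (Suc n)
  have "(\<integral>\<^sup>+x. ennreal (exp (- x)) \<partial>renewal_law F (Suc n))
      = (\<integral>\<^sup>+x. \<integral>\<^sup>+y. ennreal (exp (- x)) * ennreal (exp (- y)) \<partial>renewal_law F n \<partial>F)"
    by (subst nn_integral_renewal_law_Suc) (auto simp: exp_add exp_diff ennreal_mult[symmetric] exp_minus field_simps)
  also have "\<dots> = (\<integral>\<^sup>+x. ennreal (exp (- x)) \<partial>F) * ennreal (laplace ^ n)"
    by (simp add: nn_integral_cmult nn_integral_multc Suc)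
  also have "(\<integral>\<^sup>+x. ennreal (exp (- x)) \<partial>F) = ennreal laplace"
    unfolding laplace_def by (rule nn_integral_eq_integral[OF integrable_exp]) auto
  finally show ?case by (simp add: ennreal_mult laplace_nonneg)
qed (simp add: renewal_law.simps nn_integral_return)

lemma renewal_cdf_le: "cdf (renewal_law F n) t \<le> exp t * laplace ^ n"
proof -
  interpret L: real_distribution "renewal_law F n" by (rule real_distribution_renewal_law)
  have "ennreal (cdf (renewal_law F n) t) = (\<integral>\<^sup>+x. indicator {..t} x \<partial>renewal_law F n)"
    by (simp add: cdf_def L.emeasure_eq_measure)
  \<comment> \<open>\<open>exp (t - x)\<close> is at least 1 for \<open>x\<close> \<le>
    \<open>t\<close> and positive elsewhere, so it dominates the indicator.\<close>
  also have "\<dots> \<le> (\<integral>\<^sup>+x. ennreal (exp t) * ennreal (exp (- x)) \<partial>renewal_law F n)"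
    by (intro nn_integral_mono) (auto simp: ennreal_mult[symmetric] exp_add[symmetric] split: split_indicator simp del: ennreal_1 simp add: ennreal_1[symmetric])
  also have "\<dots> = ennreal (exp t * laplace ^ n)"
    by (simp add: nn_integral_cmult nn_integral_exp_renewal_law ennreal_mult laplace_nonneg)
  finally show ?thesis
    by (subst (asm) ennreal_le_iff) (auto simp: laplace_nonneg)
qed

lemma renewal_cdf_tendsto_0: "(\<lambda>n. cdf (renewal_law F n) t) \<longlonglongrightarrow> 0"
proof (rule tendsto_sandwich[OF _ _ tendsto_const])
  show "(\<lambda>n. exp t * laplace ^ n) \<longlonglongrightarrow> 0"
    using laplace_nonneg laplace_less_1 by (intro tendsto_mult_right_zero LIMSEQ_power_zero) simp
qed (auto simp: renewal_cdf_bounds renewal_cdf_le)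

lemma summable_laplace_bound: "summable (\<lambda>n. exp t * laplace ^ n)"
  using laplace_nonneg laplace_less_1 by (intro summable_mult summable_geometric) simp

section \<open>The alternating series for the expected value\<close>

lemma switch_mean_term_le:
  "\<bar>(- 1) ^ n * (cdf (renewal_law F n) t - cdf (renewal_law F (Suc n)) t)\<bar> \<le> exp t * laplace ^ n"
  using renewal_cdf_Suc_le[of n t] renewal_cdf_le[of n t] renewal_cdf_bounds(1)[of "Suc n" t]
  by (simp add: abs_mult)

lemma summable_switch_mean:
  "summable (\<lambda>n. \<bar>(- 1) ^ n * (cdf (renewal_law F n) t - cdf (renewal_law F (Suc n)) t)\<bar>)"
  by (rule summable_comparison_test'[OF summable_laplace_bound[of t], of 0]) (use switch_mean_term_le in auto)

lemma switch_mean_sums: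
  "(\<lambda>n. (- 1) ^ n * (cdf (renewal_law F n) t - cdf (renewal_law F (Suc n)) t)) sums switch_mean F t"
  unfolding switch_mean_def by (rule summable_sums[OF summable_rabs_cancel[OF summable_switch_mean]])

lemma borel_measurable_switch_mean [measurable]: "switch_mean F \<in> borel_measurable borel"
  unfolding switch_mean_def[abs_def] by measurable

lemma switch_mean_neg: "t < 0 \<Longrightarrow> switch_mean F t = 0"
  by (simp add: switch_mean_def renewal_cdf_neg)

text \<open>Without the signs the terms are nonnegative and telescope to
  \<open>cdf (renewal_law F 0) t\<close>, which is at most 1.\<close>

lemma abs_switch_mean_le_1: "\<bar>switch_mean F t\<bar> \<le> 1"
proof -
  have s: "(\<lambda>n. cdf (renewal_law F n) t - cdf (renewal_law F (Suc n)) t) sums cdf (renewal_law F 0) t"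
    using telescope_sums'[OF renewal_cdf_tendsto_0[of t]] by simp
  have "\<bar>switch_mean F t\<bar> \<le> (\<Sum>n. \<bar>(- 1) ^ n * (cdf (renewal_law F n) t - cdf (renewal_law F (Suc n)) t)\<bar>)"
    unfolding switch_mean_def by (rule summable_rabs[OF summable_switch_mean])
  also have "\<dots> = cdf (renewal_law F 0) t"
    using sums_unique[OF s] renewal_cdf_Suc_le by (simp add: abs_mult abs_of_nonneg)
  finally show ?thesis using renewal_cdf_bounds(2)[of 0 t] by linarith
qed

lemma continuous_on_switch_mean: "continuous_on {0..} (switch_mean F)"
proof -
  have c: "continuous_on {0..b} (switch_mean F)" for b
    unfolding switch_mean_def[abs_def]
  proof (rule uniform_limit_theorem)
    show "uniform_limit {0..b}
      (\<lambda>m t. \<Sum>n<m. (- 1) ^ n * (cdf (renewal_law F n) t - cdf (renewal_law F (Suc n)) t))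
      (\<lambda>t. \<Sum>n. (- 1) ^ n * (cdf (renewal_law F n) t - cdf (renewal_law F (Suc n)) t)) sequentially"
    proof (rule Weierstrass_m_test[OF _ summable_laplace_bound[of b]])
      fix n t assume "t \<in> {0..b}"
      then have "exp t * laplace ^ n \<le> exp b * laplace ^ n"
        by (intro mult_right_mono) (auto simp: laplace_nonneg)
      then show "norm ((- 1) ^ n * (cdf (renewal_law F n) t - cdf (renewal_law F (Suc n)) t)) \<le> exp b * laplace ^ n"
        using switch_mean_term_le[of n t] by (simp)
    qed
    show "\<forall>\<^sub>F m in sequentially. continuous_on {0..b}
       (\<lambda>t. \<Sum>n<m. (- 1) ^ n * (cdf (renewal_law F n) t - cdf (renewal_law F (Suc n)) t))"
      by (intro always_eventually allI continuous_intros continuous_on_subset[OF continuous_on_renewal_cdf]) auto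
  qed simp
  show ?thesis
    unfolding continuous_on_eq_continuous_within
  proof
    fix x :: real assume x: "x \<in> {0..}"
    have "continuous (at x within {0..x + 1}) (switch_mean F)"
      using c[of "x + 1"] x by (simp add: continuous_on_eq_continuous_within)
    \<comment> \<open>Continuity is local: the bounded interval and the half-line agree near
      \<open>x\<close>, which is why the interval reaches past \<open>x\<close>.\<close>
    moreover have "at x within {0..x + 1} = at x within {0..}"
      by (rule at_within_nhd[of _ "{..<x + 1}"]) (auto simp: x)
    ultimately show "continuous (at x within {0..}) (switch_mean F)" by simp
  qed
qed

text \<open>Convolution with \<open>F\<close> moves each term to the next index, and the alternation
  turns this into a change of sign, so the result is minus the series without its first term. The
  indicator extends this renewal equation to negative \<open>t\<close>, where both sides
  vanish.\<close>

lemma integral_switch_mean_shift: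
  "(\<integral>u. switch_mean F (t - u) \<partial>F) = indicator {0..} t - cdf F t - switch_mean F t"
proof -
  let ?d = "\<lambda>n t. cdf (renewal_law F n) t - cdf (renewal_law F (Suc n)) t"
  have int: "integrable F (\<lambda>u. cdf (renewal_law F n) (t - u))" for n
    by (rule integrable_const_bound[of _ 1]) (auto simp: renewal_cdf_bounds)
  \<comment> \<open>\<open>u\<close> > 0 almost surely gives \<open>exp (t - u)\<close> \<le>
    \<open>exp t\<close>, a majorant free of \<open>u\<close> that permits termwise
    integration.\<close>
  have bound: "AE u in F. \<bar>(- 1) ^ n * ?d n (t - u)\<bar> \<le> exp t * laplace ^ n" for n
    using law_pos
  proof eventually_elim
    case (elim u)
    then have "exp (t - u) * laplace ^ n \<le> exp t * laplace ^ n"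
      by (intro mult_right_mono) (auto simp: laplace_nonneg)
    then show ?case using switch_mean_term_le[of n "t - u"] by linarith
  qed
  have "(\<lambda>n. \<integral>u. (- 1) ^ n * ?d n (t - u) \<partial>F) sums (\<integral>u. (\<Sum>n. (- 1) ^ n * ?d n (t - u)) \<partial>F)"
  proof (rule sums_integral)
    show "integrable F (\<lambda>u. (- 1) ^ n * ?d n (t - u))" for n
      using int by (simp)
    show "AE u in F. summable (\<lambda>n. norm ((- 1) ^ n * ?d n (t - u)))"
      using summable_switch_mean by (simp)
    show "summable (\<lambda>n. \<integral>u. norm ((- 1) ^ n * ?d n (t - u)) \<partial>F)"
    proof (rule summable_comparison_test'[OF summable_laplace_bound[of t], of 0])
      fix n
      have "(\<integral>u. norm ((- 1) ^ n * ?d n (t - u)) \<partial>F) \<le> (\<integral>u. exp t * laplace ^ n \<partial>F)"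
        using bound int by (intro integral_mono_AE) (auto)
      then show "norm (\<integral>u. norm ((- 1) ^ n * ?d n (t - u)) \<partial>F) \<le> exp t * laplace ^ n"
        by (simp add:)
    qed
  qed
  then have "(\<lambda>n. \<integral>u. (- 1) ^ n * ?d n (t - u) \<partial>F) sums (\<integral>u. switch_mean F (t - u) \<partial>F)"
    by (simp only: switch_mean_def)
  moreover have "(\<integral>u. (- 1) ^ n * ?d n (t - u) \<partial>F) = - ((- 1) ^ Suc n * ?d (Suc n) t)" for n
    using int by (simp add: renewal_cdf_Suc[symmetric])
  ultimately have "(\<lambda>n. - ((- 1) ^ Suc n * ?d (Suc n) t)) sums (\<integral>u. switch_mean F (t - u) \<partial>F)"
    by (simp only:)
  then have "(\<lambda>n. (- 1) ^ Suc n * ?d (Suc n) t) sums (- (\<integral>u. switch_mean F (t - u) \<partial>F))"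
    using sums_minus by fastforce
  \<comment> \<open>The missing term \<open>?d 0 t\<close> is put back; it equals
    \<open>indicator {0..} t - cdf F t\<close>.\<close>
  then have "(\<lambda>n. (- 1) ^ n * ?d n t) sums (- (\<integral>u. switch_mean F (t - u) \<partial>F) + ?d 0 t)"
    by (subst (asm) sums_Suc_iff) simp
  from sums_unique2[OF this switch_mean_sums] show ?thesis
    using renewal_cdf_1 renewal_cdf_0[of t] by (simp)
qed

end

section \<open>Sample paths of the switch process\<close>

locale switching_sequence = switching_law F f for F f +
  fixes M :: "'a measure" and T :: "nat \<Rightarrow> 'a \<Rightarrow> real"
  assumes times: "switching_times M F T"
begin

sublocale M: prob_space M
  using times by (simp add: switching_times_def)

lemma indep_times: "M.indep_vars (\<lambda>_. borel) T {1..}"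
  and distr_times: "1 \<le> k \<Longrightarrow> distr M borel (T k) = F"
  using times by (auto simp: switching_times_def)

lemma measurable_times: "1 \<le> k \<Longrightarrow> T k \<in> borel_measurable M"
  using indep_times by (auto simp: M.indep_vars_def)

definition renewal_time :: "nat \<Rightarrow> 'a \<Rightarrow> real" where
  "renewal_time n \<omega> = (\<Sum>k=1..n. T k \<omega>)"

lemma measurable_renewal_time [measurable]: "renewal_time n \<in> borel_measurable M"
  unfolding renewal_time_def[abs_def] by (intro borel_measurable_sum measurable_times) auto

lemma distr_renewal_time: "distr M borel (renewal_time n) = renewal_law F n"
proof (induction n)
  case 0
  show ?case by (simp add: renewal_time_def[abs_def] renewal_law.simps)
next
  case (Suc n)
  have "M.indep_vars (\<lambda>_. borel) T (insert (Suc n) {1..n})"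
    by (rule M.indep_vars_subset[OF indep_times]) auto
  then have "M.indep_var borel (T (Suc n)) borel (renewal_time n)"
    unfolding renewal_time_def[abs_def] by (intro M.indep_vars_sum) auto
  then have "distr M borel (\<lambda>\<omega>. T (Suc n) \<omega> + renewal_time n \<omega>) = convolution F (renewal_law F n)"
    using Suc distr_times[of "Suc n"] measurable_times[of "Suc n"] by (simp add: M.sum_indep_random_variable)
  then show ?case by (simp add: renewal_time_def[abs_def] renewal_law.simps add.commute)
qed

lemma prob_renewal_time_le: "M.prob {\<omega> \<in> space M. renewal_time n \<omega> \<le> t} = cdf (renewal_law F n) t"
  unfolding cdf_def distr_renewal_time[symmetric]
  by (subst measure_distr) (auto intro!: arg_cong[where f=M.prob])

text \<open>The paths on which the epochs are ordered and unbounded. There, for \<open>t\<close>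
  \<ge> 0, the set under the supremum in \<open>switch_count\<close> is a finite initial segment, so
  its supremum counts the switches.\<close>

definition regular :: "'a \<Rightarrow> bool" where
  "regular \<omega> \<longleftrightarrow> (\<forall>k\<ge>1. 0 \<le> T k \<omega>) \<and> (\<forall>t. \<exists>n. t < renewal_time n \<omega>)"

text \<open>The event that all epochs stay at or below \<open>t\<close> has probability at most
  \<open>cdf (renewal_law F n) t\<close> for every \<open>n\<close>, and this tends to 0.\<close>

lemma AE_renewal_time_exceeds: "AE \<omega> in M. \<exists>n. t < renewal_time n \<omega>"
proof -
  let ?N = "{\<omega> \<in> space M. \<forall>n. renewal_time n \<omega> \<le> t}"
  have "M.prob ?N \<le> cdf (renewal_law F n) t" for n
    unfolding prob_renewal_time_le[symmetric] by (rule M.finite_measure_mono) auto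
  then have "M.prob ?N \<le> 0"
    by (intro LIMSEQ_le_const[OF renewal_cdf_tendsto_0]) auto
  then have "?N \<in> null_sets M"
    by (intro null_setsI) (auto simp: M.emeasure_eq_measure intro: antisym)
  then show ?thesis
    by (rule AE_I') (auto simp: not_less)
qed

lemma AE_regular: "AE \<omega> in M. regular \<omega>"
proof -
  \<comment> \<open>Integer levels keep the null sets countable in number; every real level lies
    below some integer.\<close>
  have "AE \<omega> in M. \<forall>m::nat. \<exists>n. real m < renewal_time n \<omega>"
    unfolding AE_all_countable using AE_renewal_time_exceeds by blast
  moreover have "AE \<omega> in M. 1 \<le> k \<longrightarrow> 0 \<le> T k \<omega>" for k
    using times by (cases "1 \<le> k") (auto simp: switching_times_def)
  then have "AE \<omega> in M. \<forall>k\<ge>1. 0 \<le> T k \<omega>"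
    unfolding AE_all_countable by blast
  ultimately show ?thesis
  proof eventually_elim
    case (elim \<omega>)
    have "\<exists>n. t < renewal_time n \<omega>" for t
      using elim(1) reals_Archimedean2[of t] by (meson less_trans)
    with elim show ?case by (simp add: regular_def)
  qed
qed

lemma renewal_time_mono: "regular \<omega> \<Longrightarrow> m \<le> n \<Longrightarrow> renewal_time m \<omega> \<le> renewal_time n \<omega>"
  unfolding renewal_time_def by (rule sum_mono2) (auto simp: regular_def)

lemma renewal_interval_exists:
  assumes "regular \<omega>" "0 \<le> t"
  obtains n where "renewal_time n \<omega> \<le> t" "t < renewal_time (Suc n) \<omega>"
proof -
  define m where "m = (LEAST n. t < renewal_time n \<omega>)"
  have m: "t < renewal_time m \<omega>"
    using assms(1) unfolding m_def regular_def by (auto intro: LeastI_ex)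
  \<comment> \<open>Epoch 0 is at time 0 \<le> \<open>t\<close>, so the least index is a
    successor.\<close>
  then obtain n where n: "m = Suc n"
    using assms(2) by (cases m) (auto simp: renewal_time_def)
  then have "renewal_time n \<omega> \<le> t"
    using not_less_Least[of n "\<lambda>n. t < renewal_time n \<omega>"] by (auto simp: m_def not_less)
  with m n that show thesis by blast
qed

lemma renewal_time_le_iff:
  assumes "regular \<omega>" "renewal_time n \<omega> \<le> t" "t < renewal_time (Suc n) \<omega>"
  shows "renewal_time m \<omega> \<le> t \<longleftrightarrow> m \<le> n"
  using renewal_time_mono[OF assms(1), of m n] renewal_time_mono[OF assms(1), of "Suc n" m] assms
  by (cases "m \<le> n") auto

lemma switch_count_eq:
  assumes "regular \<omega>" "renewal_time n \<omega> \<le> t" "t < renewal_time (Suc n) \<omega>"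
  shows "switch_count T t \<omega> = n"
proof -
  have "{m. (\<Sum>k=1..m. T k \<omega>) \<le> t} = {..n}"
    using renewal_time_le_iff[OF assms] by (auto simp: renewal_time_def)
  then have Sup: "Sup {m. (\<Sum>k=1..m. T k \<omega>) \<le> t} = n"
    by simp
  \<comment> \<open>The branch \<open>t < T 1 \<omega>\<close> of \<open>switch_count\<close> agrees
    with the supremum, since \<open>T 1\<close> is the first epoch.\<close>
  have "n = 0" if "t < T 1 \<omega>"
    using renewal_time_le_iff[OF assms, of 1] that by (simp add: renewal_time_def)
  with Sup show ?thesis by (auto simp: switch_count_def)
qed

text \<open>The time is random because the stationary process evaluates its switch processes at
  \<open>t - A\<close> and \<open>- (t + B)\<close>.\<close>

lemma measurable_switch_count:
  assumes [measurable]: "\<tau> \<in> borel_measurable M"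
  shows "(\<lambda>\<omega>. switch_count T (\<tau> \<omega>) \<omega>) \<in> measurable M (count_space UNIV)"
proof -
  have [measurable]: "T 1 \<in> borel_measurable M" by (simp add: measurable_times)
  show ?thesis
    unfolding switch_count_def renewal_time_def[symmetric] by measurable
qed

lemma borel_measurable_switch_sign:
  assumes "\<tau> \<in> borel_measurable M"
  shows "(\<lambda>\<omega>. (- 1) ^ switch_count T (\<tau> \<omega>) \<omega> :: real) \<in> borel_measurable M"
  using measurable_switch_count[OF assms] by measurable

text \<open>On a regular path the difference of truth values is 1 only when \<open>n\<close> is the
  number of switches, so a single term survives. This is the pathwise form of
  \<open>switch_mean\<close>.\<close>

lemma switch_sign_sums:
  assumes "regular \<omega>" "0 \<le> t"
  shows "(\<lambda>n. (- 1) ^ n * (of_bool (renewal_time n \<omega> \<le> t) - of_bool (renewal_time (Suc n) \<omega> \<le> t)))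
    sums ((- 1) ^ switch_count T t \<omega> :: real)"
proof -
  obtain n where n: "renewal_time n \<omega> \<le> t" "t < renewal_time (Suc n) \<omega>"
    using renewal_interval_exists[OF assms] .
  have "(\<lambda>m. (- 1) ^ m * (of_bool (m \<le> n) - of_bool (Suc m \<le> n))) sums
    (\<Sum>m\<in>{n}. (- 1) ^ m * (of_bool (m \<le> n) - of_bool (Suc m \<le> n)) :: real)"
    by (rule sums_finite) auto
  then show ?thesis
    by (simp add: renewal_time_le_iff[OF assms(1) n] switch_count_eq[OF assms(1) n])
qed

text \<open>The count is constant on each half-open interval between consecutive epochs, and a
  sequence tending to \<open>s\<close> from the right eventually stays in the interval containing
  \<open>s\<close>.\<close>

lemma switch_sign_right_continuous:
  assumes "regular \<omega>" "0 \<le> s" "\<And>n. s \<le> r n" "r \<longlonglongrightarrow> s"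
  shows "(\<lambda>n. (- 1) ^ switch_count T (r n) \<omega> :: real) \<longlonglongrightarrow> (- 1) ^ switch_count T s \<omega>"
proof -
  obtain n where n: "renewal_time n \<omega> \<le> s" "s < renewal_time (Suc n) \<omega>"
    using renewal_interval_exists[OF assms(1,2)] .
  have "\<forall>\<^sub>F k in sequentially. r k < renewal_time (Suc n) \<omega>"
    using n assms(4) by (auto intro: order_tendstoD)
  then have "\<forall>\<^sub>F k in sequentially. (- 1) ^ switch_count T (r k) \<omega> = ((- 1) ^ switch_count T s \<omega> :: real)"
  proof eventually_elim
    case (elim k)
    then show ?case
      using n assms(3)[of k] by (simp add: switch_count_eq[OF assms(1), of n])
  qed
  then show ?thesis by (rule tendsto_eventually)
qed

text \<open>The expectation of \<open>switch_sign_sums\<close> is taken term by term. Epochs are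
  ordered almost surely, so the absolute values have expectations that telescope, which justifies
  the interchange.\<close>

lemma expectation_switch_sign:
  assumes "0 \<le> t"
  shows "(\<integral>\<omega>. (- 1) ^ switch_count T t \<omega> \<partial>M) = switch_mean F t"
proof -
  let ?b = "\<lambda>n \<omega>. of_bool (renewal_time n \<omega> \<le> t) :: real"
  let ?d = "\<lambda>n. cdf (renewal_law F n) t - cdf (renewal_law F (Suc n)) t"
  have int: "integrable M (?b n)" for n
    by (rule M.integrable_const_bound[of _ 1]) auto
  have exp_b: "(\<integral>\<omega>. ?b n \<omega> \<partial>M) = cdf (renewal_law F n) t" for n
  proof -
    have "(\<integral>\<omega>. ?b n \<omega> \<partial>M) = (\<integral>\<omega>. indicator {\<omega> \<in> space M. renewal_time n \<omega> \<le> t} \<omega> \<partial>M)"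
      by (intro Bochner_Integration.integral_cong) auto
    then show ?thesis by (simp add: prob_renewal_time_le)
  qed
  have mono: "AE \<omega> in M. ?b (Suc n) \<omega> \<le> ?b n \<omega>" for n
    using AE_regular by eventually_elim (use renewal_time_mono[of _ n "Suc n"] in force)
  have norm: "(\<integral>\<omega>. norm ((- 1) ^ n * (?b n \<omega> - ?b (Suc n) \<omega>)) \<partial>M) = ?d n" for n
  proof -
    have "(\<integral>\<omega>. norm ((- 1) ^ n * (?b n \<omega> - ?b (Suc n) \<omega>)) \<partial>M) = (\<integral>\<omega>. ?b n \<omega> - ?b (Suc n) \<omega> \<partial>M)"
      using mono[of n] by (intro integral_cong_AE) (auto simp: abs_mult)
    then show ?thesis using int by (simp add: exp_b)
  qed
  have "(\<lambda>n. \<integral>\<omega>. (- 1) ^ n * (?b n \<omega> - ?b (Suc n) \<omega>) \<partial>M)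
      sums (\<integral>\<omega>. (\<Sum>n. (- 1) ^ n * (?b n \<omega> - ?b (Suc n) \<omega>)) \<partial>M)"
  proof (rule sums_integral)
    show "AE \<omega> in M. summable (\<lambda>n. norm ((- 1) ^ n * (?b n \<omega> - ?b (Suc n) \<omega>)))"
      using AE_regular
    proof eventually_elim
      case (elim \<omega>)
      obtain n where n: "renewal_time n \<omega> \<le> t" "t < renewal_time (Suc n) \<omega>"
        using renewal_interval_exists[OF elim assms] .
      show ?case
        by (rule summable_finite[of "{n}"]) (auto simp: renewal_time_le_iff[OF elim n])
    qed
    show "summable (\<lambda>n. \<integral>\<omega>. norm ((- 1) ^ n * (?b n \<omega> - ?b (Suc n) \<omega>)) \<partial>M)"
      unfolding norm by (rule telescope_summable'[OF renewal_cdf_tendsto_0])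
  qed (use int in simp)
  moreover have "(\<integral>\<omega>. (- 1) ^ n * (?b n \<omega> - ?b (Suc n) \<omega>) \<partial>M) = (- 1) ^ n * ?d n" for n
    using int by (simp add: exp_b)
  ultimately have "(\<lambda>n. (- 1) ^ n * ?d n) sums (\<integral>\<omega>. (\<Sum>n. (- 1) ^ n * (?b n \<omega> - ?b (Suc n) \<omega>)) \<partial>M)"
    by simp
  also have "(\<integral>\<omega>. (\<Sum>n. (- 1) ^ n * (?b n \<omega> - ?b (Suc n) \<omega>)) \<partial>M) = (\<integral>\<omega>. (- 1) ^ switch_count T t \<omega> \<partial>M)"
  proof (rule integral_cong_AE)
    show "AE \<omega> in M. (\<Sum>n. (- 1) ^ n * (?b n \<omega> - ?b (Suc n) \<omega>)) = (- 1) ^ switch_count T t \<omega>"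
      using AE_regular
      by eventually_elim (use switch_sign_sums[OF _ assms] in \<open>simp add: sums_iff\<close>)
  qed (use borel_measurable_switch_sign[of "\<lambda>_. t"] in auto)
  finally show ?thesis
    using switch_mean_sums by (rule sums_unique2)
qed

end

section \<open>Evaluation of a process at an independent time\<close>

text \<open>The points are the first multiples of \<open>1 / real (Suc m)\<close> strictly above
  \<open>x\<close>, at distance at most the mesh. Approximation from above is what right-continuous
  paths require.\<close>

lemma tendsto_grid_ceiling: "(\<lambda>m. real_of_int (\<lfloor>real (Suc m) * x\<rfloor> + 1) / real (Suc m)) \<longlonglongrightarrow> x"
proof (rule tendsto_sandwich[OF _ _ tendsto_const])
  show "(\<lambda>m. x + 1 / real (Suc m)) \<longlonglongrightarrow> x"
    using tendsto_add[OF tendsto_const LIMSEQ_inverse_real_of_nat, of x] by (simp add: inverse_eq_divide)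
  show "\<forall>\<^sub>F m in sequentially. x \<le> real_of_int (\<lfloor>real (Suc m) * x\<rfloor> + 1) / real (Suc m)"
    by (intro always_eventually allI) (simp add: field_simps del: of_nat_Suc, linarith)
  have "real_of_int (\<lfloor>real (Suc m) * x\<rfloor> + 1) / real (Suc m) \<le> (real (Suc m) * x + 1) / real (Suc m)" for m
    by (intro divide_right_mono) auto
  also have "(real (Suc m) * x + 1) / real (Suc m) = x + 1 / real (Suc m)" for m
    by (simp add: field_simps)
  finally show "\<forall>\<^sub>F m in sequentially. real_of_int (\<lfloor>real (Suc m) * x\<rfloor> + 1) / real (Suc m) \<le> x + 1 / real (Suc m)"
    by (intro always_eventually allI)
qed

lemma grid_ceiling_ge: "x \<le> real_of_int (\<lfloor>real (Suc m) * x\<rfloor> + 1) / real (Suc m)"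
  by (simp add: field_simps del: of_nat_Suc, linarith)

text \<open>A nonnegative \<open>x\<close> lies in exactly one of the grid cells, finitely many
  thanks to the bound \<open>t\<close>; a negative \<open>x\<close> lies in none, whence the factor
  \<open>of_bool (0 \<le> x)\<close>. A value at a random time thus becomes a finite sum of products
  of a cell indicator and a value at a fixed time.\<close>

lemma grid_sum_eq:
  fixes g :: "real \<Rightarrow> real"
  assumes "x \<le> t"
  shows "(\<Sum>j\<le>nat \<lfloor>real (Suc m) * t\<rfloor>. of_bool (\<lfloor>real (Suc m) * x\<rfloor> = int j) * g (real (Suc j) / real (Suc m)))
    = of_bool (0 \<le> x) * g (real_of_int (\<lfloor>real (Suc m) * x\<rfloor> + 1) / real (Suc m))"
proof (cases "0 \<le> x")
  case True
  define k where "k = nat \<lfloor>real (Suc m) * x\<rfloor>"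
  have k: "\<lfloor>real (Suc m) * x\<rfloor> = int k"
    using True by (simp add: k_def)
  have "k \<le> nat \<lfloor>real (Suc m) * t\<rfloor>"
    unfolding k_def using assms by (intro nat_mono floor_mono mult_left_mono) auto
  moreover have "of_bool (int k = int j) * g (real (Suc j) / real (Suc m)) = (if k = j then g (real (Suc j) / real (Suc m)) else 0)" for j
    by auto
  ultimately show ?thesis
    using True unfolding k by (simp add: add.commute)
next
  case False
  then have "\<lfloor>real (Suc m) * x\<rfloor> < 0"
    by (simp add: mult_less_0_iff del: of_nat_Suc)
  then have "\<lfloor>real (Suc m) * x\<rfloor> \<noteq> int j" for j
    by linarith
  then show ?thesis using False by simp
qed

context prob_space
begin

text \<open>
  Pointwise independence of \<open>\<tau>\<close> and the single values \<open>Z s\<close> suffices: right continuity reduces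
  \<open>Z (\<tau> \<omega>) \<omega>\<close> to evaluations at finitely many grid points above \<open>\<tau> \<omega>\<close>.
\<close>

lemma expectation_at_independent_time:
  fixes \<tau> :: "'a \<Rightarrow> real" and Z :: "real \<Rightarrow> 'a \<Rightarrow> real" and e :: "real \<Rightarrow> real"
  assumes indep: "\<And>s. 0 \<le> s \<Longrightarrow> indep_var borel \<tau> borel (Z s)"
    and bound: "\<And>s \<omega>. 0 \<le> s \<Longrightarrow> \<omega> \<in> space M \<Longrightarrow> \<bar>Z s \<omega>\<bar> \<le> 1"
    and rcont: "AE \<omega> in M. \<forall>s\<ge>0. \<forall>r. (\<forall>n::nat. s \<le> r n) \<longrightarrow> r \<longlonglongrightarrow> s \<longrightarrow> (\<lambda>n. Z (r n) \<omega>) \<longlonglongrightarrow> Z s \<omega>"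
    and meas: "(\<lambda>\<omega>. of_bool (0 \<le> \<tau> \<omega>) * Z (\<tau> \<omega>) \<omega>) \<in> borel_measurable M"
    and mean: "\<And>s. 0 \<le> s \<Longrightarrow> (\<integral>\<omega>. Z s \<omega> \<partial>M) = e s"
    and cont: "continuous_on {0..} e"
    and e_meas [measurable]: "e \<in> borel_measurable borel"
    and le: "AE \<omega> in M. \<tau> \<omega> \<le> t"
  shows "(\<integral>\<omega>. of_bool (0 \<le> \<tau> \<omega>) * Z (\<tau> \<omega>) \<omega> \<partial>M) = (\<integral>\<omega>. of_bool (0 \<le> \<tau> \<omega>) * e (\<tau> \<omega>) \<partial>M)"
proof -
  define S where "S m g x = (\<Sum>j\<le>nat \<lfloor>real (Suc m) * t\<rfloor>.
    of_bool (\<lfloor>real (Suc m) * x\<rfloor> = int j) * g (real (Suc j) / real (Suc m)))" for m and g :: "real \<Rightarrow> real" and x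
  have S_eq: "S m g x = of_bool (0 \<le> x) * g (real_of_int (\<lfloor>real (Suc m) * x\<rfloor> + 1) / real (Suc m))"
    if "x \<le> t" for m g x
    unfolding S_def by (rule grid_sum_eq[OF that])
  have rv_\<tau> [measurable]: "\<tau> \<in> borel_measurable M"
    using indep[of 0] by (simp add: indep_var_eq)
  have rv_Z [measurable]: "Z (real j / real m) \<in> borel_measurable M" for j m :: nat
    using indep[of "real j / real m"] by (simp add: indep_var_eq)
  have int_Z: "integrable M (Z s)" if "0 \<le> s" for s
    using indep[OF that] bound[OF that] by (intro integrable_const_bound[of _ 1]) (auto simp: indep_var_eq)
  have e_bound: "\<bar>e s\<bar> \<le> 1" if "0 \<le> s" for s
  proof -
    have "\<bar>e s\<bar> \<le> (\<integral>\<omega>. \<bar>Z s \<omega>\<bar> \<partial>M)"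
      using mean[OF that] integral_abs_bound[of M "Z s"] by simp
    also have "\<dots> \<le> (\<integral>\<omega>. 1 \<partial>M)"
      using bound[OF that] int_Z[OF that] by (intro integral_mono) auto
    finally show ?thesis by (simp add: prob_space)
  qed
  have term_eq: "(\<integral>\<omega>. of_bool (\<lfloor>real (Suc m) * \<tau> \<omega>\<rfloor> = int j) * Z (real (Suc j) / real (Suc m)) \<omega> \<partial>M)
      = (\<integral>\<omega>. of_bool (\<lfloor>real (Suc m) * \<tau> \<omega>\<rfloor> = int j) \<partial>M) * e (real (Suc j) / real (Suc m))"
    and term_int: "integrable M (\<lambda>\<omega>. of_bool (\<lfloor>real (Suc m) * \<tau> \<omega>\<rfloor> = int j) * Z (real (Suc j) / real (Suc m)) \<omega>)"
    and term_int': "integrable M (\<lambda>\<omega>. of_bool (\<lfloor>real (Suc m) * \<tau> \<omega>\<rfloor> = int j) :: real)" for m j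
  proof -
    let ?s = "real (Suc j) / real (Suc m)" and ?h = "\<lambda>x. of_bool (\<lfloor>real (Suc m) * x\<rfloor> = int j) :: real"
    have s: "0 \<le> ?s" by simp
    have "indep_var borel (?h \<circ> \<tau>) borel (id \<circ> Z ?s)"
      by (rule indep_var_compose[OF indep[OF s]]) auto
    then have ind: "indep_var borel (\<lambda>\<omega>. ?h (\<tau> \<omega>)) borel (Z ?s)"
      by (simp add: comp_def)
    show int_h: "integrable M (\<lambda>\<omega>. ?h (\<tau> \<omega>))"
      by (rule integrable_const_bound[of _ 1]) auto
    show "integrable M (\<lambda>\<omega>. ?h (\<tau> \<omega>) * Z ?s \<omega>)"
      by (rule indep_var_integrable[OF ind int_h int_Z[OF s]])
    show "(\<integral>\<omega>. ?h (\<tau> \<omega>) * Z ?s \<omega> \<partial>M) = (\<integral>\<omega>. ?h (\<tau> \<omega>) \<partial>M) * e ?s"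
      unfolding mean[OF s, symmetric] by (rule indep_var_lebesgue_integral[OF ind int_h int_Z[OF s]])
  qed
  \<comment> \<open>Cell indicators depend on \<open>\<tau>\<close> only and are independent of
    \<open>Z\<close> at a fixed grid point, so replacing that value by its mean changes no
    expectation.\<close>
  have grid: "(\<integral>\<omega>. S m (\<lambda>s. Z s \<omega>) (\<tau> \<omega>) \<partial>M) = (\<integral>\<omega>. S m e (\<tau> \<omega>) \<partial>M)" for m
    unfolding S_def using term_int term_int' by (simp only: Bochner_Integration.integral_sum integrable_mult_left integral_mult_left_zero term_eq)
  have nonneg: "0 \<le> real_of_int (\<lfloor>real (Suc m) * x\<rfloor> + 1) / real (Suc m)" if "0 \<le> x" for m x
    using grid_ceiling_ge[of x m] that by linarith
  \<comment> \<open>As the grid is refined, right continuity of the paths gives the pointwise limit,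
    and the constant 1 dominates.\<close>
  have "(\<lambda>m. \<integral>\<omega>. S m (\<lambda>s. Z s \<omega>) (\<tau> \<omega>) \<partial>M) \<longlonglongrightarrow> (\<integral>\<omega>. of_bool (0 \<le> \<tau> \<omega>) * Z (\<tau> \<omega>) \<omega> \<partial>M)"
  proof (rule integral_dominated_convergence)
    show "AE \<omega> in M. (\<lambda>m. S m (\<lambda>s. Z s \<omega>) (\<tau> \<omega>)) \<longlonglongrightarrow> of_bool (0 \<le> \<tau> \<omega>) * Z (\<tau> \<omega>) \<omega>"
      using le rcont
    proof eventually_elim
      case (elim \<omega>)
      show ?case
        unfolding S_eq[OF elim(1)]
      proof (cases "0 \<le> \<tau> \<omega>")
        case True
        then show "(\<lambda>m. of_bool (0 \<le> \<tau> \<omega>) * Z (real_of_int (\<lfloor>real (Suc m) * \<tau> \<omega>\<rfloor> + 1) / real (Suc m)) \<omega>)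
            \<longlonglongrightarrow> of_bool (0 \<le> \<tau> \<omega>) * Z (\<tau> \<omega>) \<omega>"
          by (intro tendsto_mult tendsto_const elim(2)[rule_format] tendsto_grid_ceiling grid_ceiling_ge)
      qed simp
    qed
    show "AE \<omega> in M. norm (S m (\<lambda>s. Z s \<omega>) (\<tau> \<omega>)) \<le> 1" for m
      using le AE_space
      by eventually_elim (auto simp: S_eq simp del: of_nat_Suc intro!: bound nonneg)
    show "(\<lambda>\<omega>. S m (\<lambda>s. Z s \<omega>) (\<tau> \<omega>)) \<in> borel_measurable M" for m
      unfolding S_def by measurable
  qed (use meas in auto)
  \<comment> \<open>The same limit for the means, now by continuity of \<open>e\<close> on the
    half-line.\<close>
  moreover have "(\<lambda>m. \<integral>\<omega>. S m e (\<tau> \<omega>) \<partial>M) \<longlonglongrightarrow> (\<integral>\<omega>. of_bool (0 \<le> \<tau> \<omega>) * e (\<tau> \<omega>) \<partial>M)"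
  proof (rule integral_dominated_convergence)
    show "AE \<omega> in M. (\<lambda>m. S m e (\<tau> \<omega>)) \<longlonglongrightarrow> of_bool (0 \<le> \<tau> \<omega>) * e (\<tau> \<omega>)"
      using le
    proof eventually_elim
      case (elim \<omega>)
      show ?case
        unfolding S_eq[OF elim]
      proof (cases "0 \<le> \<tau> \<omega>")
        case True
        then have "(\<lambda>m. e (real_of_int (\<lfloor>real (Suc m) * \<tau> \<omega>\<rfloor> + 1) / real (Suc m))) \<longlonglongrightarrow> e (\<tau> \<omega>)"
          using nonneg by (intro continuous_on_tendsto_compose[OF cont tendsto_grid_ceiling]) auto
        then show "(\<lambda>m. of_bool (0 \<le> \<tau> \<omega>) * e (real_of_int (\<lfloor>real (Suc m) * \<tau> \<omega>\<rfloor> + 1) / real (Suc m)))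
            \<longlonglongrightarrow> of_bool (0 \<le> \<tau> \<omega>) * e (\<tau> \<omega>)"
          by (intro tendsto_mult tendsto_const)
      qed simp
    qed
    show "AE \<omega> in M. norm (S m e (\<tau> \<omega>)) \<le> 1" for m
      using le by eventually_elim (auto simp: S_eq simp del: of_nat_Suc intro!: e_bound nonneg)
    show "(\<lambda>\<omega>. S m e (\<tau> \<omega>)) \<in> borel_measurable M" for m
      unfolding S_def by measurable
  qed auto
  ultimately show ?thesis
    unfolding grid by (rule LIMSEQ_unique)
qed

end

section \<open>The covariance function\<close>

context switching_law
begin

text \<open>The strip \<open>{0..t} \<times> UNIV\<close> has finite product measure, so bounded
  functions on it are integrable. Both exchanges of integrals below rest on this.\<close>

lemma integrable_window:
  fixes g :: "real \<times> real \<Rightarrow> real"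
  assumes "g \<in> borel_measurable (lborel \<Otimes>\<^sub>M F)" "\<And>p. \<bar>g p\<bar> \<le> 1"
  shows "integrable (lborel \<Otimes>\<^sub>M F) (\<lambda>p. indicator {0..t} (fst p) * g p)"
proof (rule integrableI_bounded_set[where A="{0..t} \<times> UNIV" and B=1])
  show "emeasure (lborel \<Otimes>\<^sub>M F) ({0..t} \<times> UNIV) < \<infinity>"
    using emeasure_space_1 by (subst emeasure_pair_measure_Times) (auto simp: emeasure_lborel_Icc_eq ennreal_mult_less_top)
  show "(\<lambda>p. indicator {0..t} (fst p) * g p) \<in> borel_measurable (lborel \<Otimes>\<^sub>M F)"
    using assms(1) by measurable
qed (use assms(2) in \<open>auto simp: space_pair_measure split: split_indicator\<close>)

text \<open>By the renewal equation the left integrand is the convolution of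
  \<open>switch_mean F\<close> with \<open>F\<close>. Exchanging the integrals, shifting by
  \<open>u\<close> and exchanging back collects the mass of \<open>F\<close> up to
  \<open>t - r\<close>; reflecting \<open>r\<close> to \<open>t - r\<close> gives the right
  side.\<close>

lemma integral_switch_mean_convolution:
  "(\<integral>s. indicator {0..t} s * (1 - cdf F s - switch_mean F s) \<partial>lborel)
    = (\<integral>a. indicator {0..t} a * (cdf F a * switch_mean F (t - a)) \<partial>lborel)"
proof -
  interpret pair_sigma_finite lborel F ..
  have "(\<integral>s. indicator {0..t} s * (1 - cdf F s - switch_mean F s) \<partial>lborel)
      = (\<integral>s. \<integral>u. indicator {0..t} s * switch_mean F (s - u) \<partial>F \<partial>lborel)"
    by (intro Bochner_Integration.integral_cong)
       (auto simp: integral_switch_mean_shift split: split_indicator)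
  also have "\<dots> = (\<integral>u. \<integral>s. indicator {0..t} s * switch_mean F (s - u) \<partial>lborel \<partial>F)"
    using integrable_window[of "\<lambda>p. switch_mean F (fst p - snd p)" t] abs_switch_mean_le_1
    by (intro Fubini_integral[symmetric]) (simp add: case_prod_unfold)
  also have "\<dots> = (\<integral>u. \<integral>r. indicator {0..t} r * (of_bool (u \<le> t - r) * switch_mean F r) \<partial>lborel \<partial>F)"
  proof (rule integral_cong_AE)
    show "AE u in F. (\<integral>s. indicator {0..t} s * switch_mean F (s - u) \<partial>lborel)
        = (\<integral>r. indicator {0..t} r * (of_bool (u \<le> t - r) * switch_mean F r) \<partial>lborel)"
      using law_pos
    proof eventually_elim
      case (elim u)
      have "(\<integral>s. indicator {0..t} s * switch_mean F (s - u) \<partial>lborel)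
          = (\<integral>r. indicator {0..t} (u + r) * switch_mean F r \<partial>lborel)"
        by (subst lborel_integral_real_affine[where c=1 and t=u]) auto
      also have "\<dots> = (\<integral>r. indicator {0..t} r * (of_bool (u \<le> t - r) * switch_mean F r) \<partial>lborel)"
      proof (rule Bochner_Integration.integral_cong[OF refl])
        fix r
        \<comment> \<open>As \<open>u\<close> > 0, the two windows differ only for negative
          \<open>r\<close>, where \<open>switch_mean\<close> vanishes.\<close>
        show "indicator {0..t} (u + r) * switch_mean F r
            = indicator {0..t} r * (of_bool (u \<le> t - r) * switch_mean F r)"
          using elim by (cases "r < 0") (auto simp: switch_mean_neg split: split_indicator)
      qed
      finally show ?case .
    qed
  qed measurable
  also have "\<dots> = (\<integral>r. \<integral>u. indicator {0..t} r * (of_bool (u \<le> t - r) * switch_mean F r) \<partial>F \<partial>lborel)"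
    using integrable_window[of "\<lambda>p. of_bool (snd p \<le> t - fst p) * switch_mean F (fst p)" t] abs_switch_mean_le_1
    by (intro Fubini_integral) (simp add: case_prod_unfold)
  also have "\<dots> = (\<integral>r. indicator {0..t} r * (cdf F (t - r) * switch_mean F r) \<partial>lborel)"
  proof (rule Bochner_Integration.integral_cong[OF refl])
    fix r
    have "(\<integral>u. of_bool (u \<le> t - r) \<partial>F) = (\<integral>u. indicator {..t - r} u \<partial>F :: real)"
      by (intro Bochner_Integration.integral_cong) auto
    then have "(\<integral>u. of_bool (u \<le> t - r) \<partial>F) = cdf F (t - r)"
      by (simp add: cdf_def)
    then show "(\<integral>u. indicator {0..t} r * (of_bool (u \<le> t - r) * switch_mean F r) \<partial>F)
        = indicator {0..t} r * (cdf F (t - r) * switch_mean F r)"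
      by simp
  qed
  also have "\<dots> = (\<integral>a. indicator {0..t} a * (cdf F a * switch_mean F (t - a)) \<partial>lborel)"
    by (subst lborel_integral_real_affine[where c="-1" and t=t])
       (auto intro!: Bochner_Integration.integral_cong split: split_indicator)
  finally show ?thesis .
qed

lemma borel_measurable_law_cdf [measurable]: "cdf F \<in> borel_measurable borel"
  using borel_measurable_renewal_cdf[of "Suc 0"] by (simp add: renewal_cdf_1)

text \<open>Expanding the product leaves a convolution term
  \<open>cdf F a * switch_mean F (t - a)\<close>. Trading it by
  \<open>integral_switch_mean_convolution\<close> cancels the integral of \<open>1 - cdf F\<close>
  and yields a second copy of the integral of \<open>switch_mean F\<close>.\<close>

lemma integral_tail_times_switch_mean:
  "(\<integral>a. indicator {0..t} a * ((1 - cdf F a) * (1 + switch_mean F (t - a))) \<partial>lborel)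
    = 2 * (\<integral>s. indicator {0..t} s * switch_mean F s \<partial>lborel)"
proof -
  have int: "integrable lborel (\<lambda>a. indicator {0..t} a * g a)"
    if "g \<in> borel_measurable borel" "\<And>a. \<bar>g a\<bar> \<le> 1" for g :: "real \<Rightarrow> real"
    using that by (intro integrableI_bounded_set[where A="{0..t}" and B=1])
      (auto simp: emeasure_lborel_Icc_eq split: split_indicator)
  have cdf_abs: "\<bar>1 - cdf F a\<bar> \<le> 1" "\<bar>cdf F a\<bar> \<le> 1" for a
    using renewal_cdf_bounds[of "Suc 0" a] by (auto simp: renewal_cdf_1)
  have i1: "integrable lborel (\<lambda>a. indicator {0..t} a * (1 - cdf F a))"
    and i2: "integrable lborel (\<lambda>a. indicator {0..t} a * switch_mean F (t - a))"
    and i3: "integrable lborel (\<lambda>a. indicator {0..t} a * (cdf F a * switch_mean F (t - a)))"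
    and i4: "integrable lborel (\<lambda>a. indicator {0..t} a * switch_mean F a)"
    by (intro int; use cdf_abs abs_switch_mean_le_1 in \<open>simp add: abs_mult mult_le_one\<close>)+
  have "(\<integral>a. indicator {0..t} a * ((1 - cdf F a) * (1 + switch_mean F (t - a))) \<partial>lborel)
      = (\<integral>a. indicator {0..t} a * (1 - cdf F a) + indicator {0..t} a * switch_mean F (t - a)
          - indicator {0..t} a * (cdf F a * switch_mean F (t - a)) \<partial>lborel)"
    by (intro Bochner_Integration.integral_cong) (auto simp: algebra_simps)
  also have "\<dots> = (\<integral>a. indicator {0..t} a * (1 - cdf F a) \<partial>lborel)
      + (\<integral>a. indicator {0..t} a * switch_mean F (t - a) \<partial>lborel)
      - (\<integral>a. indicator {0..t} a * (cdf F a * switch_mean F (t - a)) \<partial>lborel)"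
    using i1 i2 i3 by simp
  also have "(\<integral>a. indicator {0..t} a * switch_mean F (t - a) \<partial>lborel)
      = (\<integral>s. indicator {0..t} s * switch_mean F s \<partial>lborel)"
    by (subst lborel_integral_real_affine[where c="-1" and t=t])
       (auto intro!: Bochner_Integration.integral_cong split: split_indicator)
  also have "(\<integral>a. indicator {0..t} a * (cdf F a * switch_mean F (t - a)) \<partial>lborel)
      = (\<integral>s. indicator {0..t} s * (1 - cdf F s) - indicator {0..t} s * switch_mean F s \<partial>lborel)"
    unfolding integral_switch_mean_convolution[symmetric]
    by (intro Bochner_Integration.integral_cong) (auto simp: algebra_simps)
  also have "\<dots> = (\<integral>a. indicator {0..t} a * (1 - cdf F a) \<partial>lborel) - (\<integral>s. indicator {0..t} s * switch_mean F s \<partial>lborel)"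
    using i1 i4 by simp
  finally show ?thesis by simp
qed

section \<open>The marginal law of \<open>A\<close> and its independence from the path\<close>

lemma emeasure_law_atLeast: "emeasure F {a..} = ennreal (1 - cdf F a)"
proof -
  have "prob {..a} = prob ({..<a} \<union> {a})"
    by (rule arg_cong[where f=prob]) auto
  also have "\<dots> = prob {..<a} + prob {a}"
    by (intro finite_measure_Union) auto
  finally have "prob {..<a} = cdf F a"
    using law_singleton[of a] by (simp add: cdf_def measure_def)
  moreover have "prob {a..} = 1 - prob {..<a}"
    using prob_compl[of "{..<a}"] by (simp add: Compl_eq_Diff_UNIV[symmetric])
  ultimately show ?thesis by (simp add: emeasure_eq_measure)
qed

lemma mean_nonneg: "0 \<le> (\<integral>x. x \<partial>F)"
  using law_pos by (intro integral_nonneg_AE) auto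

text \<open>The substitution \<open>x = a + b\<close> turns the inner integral into the tail of
  \<open>F\<close> from \<open>a\<close> on, which gives the marginal density of
  \<open>A\<close>.\<close>

lemma nn_integral_joint_density:
  "(\<integral>\<^sup>+b. ennreal (if 0 \<le> a \<and> 0 \<le> b then f (a + b) / (\<integral>x. x \<partial>F) else 0) \<partial>lborel)
    = ennreal (indicator {0..} a * ((1 - cdf F a) / (\<integral>x. x \<partial>F)))"
proof (cases "0 \<le> a")
  case True
  define c where "c = 1 / (\<integral>x. x \<partial>F)"
  have c: "0 \<le> c" using mean_nonneg by (simp add: c_def)
  have "(\<integral>\<^sup>+b. ennreal (if 0 \<le> a \<and> 0 \<le> b then f (a + b) / (\<integral>x. x \<partial>F) else 0) \<partial>lborel)
      = (\<integral>\<^sup>+b. ennreal c * (ennreal (f (a + b)) * indicator {a..} (a + b)) \<partial>lborel)"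
    using True c density_nonneg
    by (intro nn_integral_cong) (auto simp: c_def ennreal_mult[symmetric] split: split_indicator)
  also have "\<dots> = ennreal c * (\<integral>\<^sup>+b. ennreal (f (a + b)) * indicator {a..} (a + b) \<partial>lborel)"
    by (intro nn_integral_cmult) measurable
  also have "(\<integral>\<^sup>+b. ennreal (f (a + b)) * indicator {a..} (a + b) \<partial>lborel) = (\<integral>\<^sup>+x. ennreal (f x) * indicator {a..} x \<partial>lborel)"
    by (subst (2) nn_integral_real_affine[where c=1 and t=a]) auto
  also have "\<dots> = emeasure F {a..}"
    by (subst law_density, subst emeasure_density) auto
  finally show ?thesis
    using True c cdf_bounded_prob[of a] by (simp add: emeasure_law_atLeast ennreal_mult[symmetric] c_def)
qed simp

end

text \<open>A law with a density charges no point. Applied to \<open>A\<close> and \<open>B\<close>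
  at 0, this makes both strictly positive, so that time 0 falls in the middle branch of the path
  definition.\<close>

lemma distributed_lborel_AE_neq:
  assumes "distributed M lborel X g"
  shows "AE \<omega> in M. X \<omega> \<noteq> c"
proof -
  have [measurable]: "g \<in> borel_measurable lborel" "X \<in> measurable M lborel"
    using assms by (auto simp: distributed_def)
  have "AE x in density lborel g. x \<noteq> c"
    using AE_lborel_singleton[of c] by (subst AE_density) auto
  moreover have "distr M lborel X = density lborel g"
    using assms by (simp add: distributed_def)
  ultimately have "AE x in distr M lborel X. x \<noteq> c"
    by (simp only:)
  then show ?thesis by (rule AE_distrD[rotated]) measurable
qed

context prob_space
begin

lemma indep_set_subset:
  "indep_set A B \<Longrightarrow> A' \<subseteq> A \<Longrightarrow> B' \<subseteq> B \<Longrightarrow> indep_set A' B'"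
  unfolding indep_sets2_eq by blast

lemma indep_sets_imp_indep_set:
  assumes "indep_sets G I" "i \<in> I" "j \<in> I" "i \<noteq> j"
  shows "indep_set (G i) (G j)"
  unfolding indep_sets2_eq
proof (intro conjI ballI)
  show "G i \<subseteq> events" "G j \<subseteq> events"
    using assms by (auto simp: indep_sets_def)
  fix a b assume "a \<in> G i" "b \<in> G j"
  then show "prob (a \<inter> b) = prob a * prob b"
    using indep_setsD[OF assms(1), of "{i, j}" "\<lambda>k. if k = i then a else b"] assms by (auto simp: Int_commute)
qed

text \<open>\<open>A\<close> is a coordinate of the pair and \<open>Xp s\<close> a coordinate of the
  path, so both are measurable for independent sigma-algebras. \<open>Z\<close> only has to agree
  with \<open>Xp s\<close> on the space, which lets the sign formula take its place.\<close>

lemma stationary_components_indep_var: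
  assumes comp: "stationary_components_indep M A B \<delta> Xp Xm"
    and [measurable]: "A \<in> borel_measurable M" "Z \<in> borel_measurable M" "g \<in> borel_measurable borel"
    and s: "0 \<le> s" and Z: "\<And>\<omega>. \<omega> \<in> space M \<Longrightarrow> Z \<omega> = Xp s \<omega>"
  shows "indep_var borel (\<lambda>\<omega>. g (A \<omega>)) borel Z"
proof -
  let ?VA = "vimage_algebra (space M) (\<lambda>\<omega>. (A \<omega>, B \<omega>)) (borel \<Otimes>\<^sub>M borel)"
  let ?VX = "vimage_algebra (space M) (process_path Xp) (Pi\<^sub>M {0..} (\<lambda>_. borel))"
  \<comment> \<open>Positions 0 and 2 of the list hold the sigma-algebras of \<open>(A, B)\<close>
    and of the path of \<open>Xp\<close>.\<close>
  have ind: "indep_set (sets ?VA) (sets ?VX)"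
    using indep_sets_imp_indep_set[OF comp[unfolded stationary_components_indep_def], of 0 2]
    by (simp add: numeral_2_eq_2)
  have "sigma_sets (space M) {(\<lambda>\<omega>. g (A \<omega>)) -` S \<inter> space M | S. S \<in> sets borel} \<subseteq> sets ?VA"
  proof (rule sets.sigma_sets_subset[of _ ?VA, simplified], safe)
    fix S :: "real set" assume [measurable]: "S \<in> sets borel"
    have "{p \<in> space (borel \<Otimes>\<^sub>M borel). g (fst p) \<in> S} \<in> sets (borel \<Otimes>\<^sub>M (borel :: real measure))"
      by measurable
    from in_vimage_algebra[OF this, of "\<lambda>\<omega>. (A \<omega>, B \<omega>)" "space M"]
    show "(\<lambda>\<omega>. g (A \<omega>)) -` S \<inter> space M \<in> sets ?VA"
      by (simp add: vimage_def space_pair_measure)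
  qed
  moreover have "sigma_sets (space M) {Z -` S \<inter> space M | S. S \<in> sets borel} \<subseteq> sets ?VX"
  proof (rule sets.sigma_sets_subset[of _ ?VX, simplified], safe)
    fix S :: "real set" assume [measurable]: "S \<in> sets borel"
    have [measurable]: "(\<lambda>x. x s) \<in> borel_measurable (Pi\<^sub>M {0..} (\<lambda>_. borel :: real measure))"
      using s by (intro measurable_component_singleton) simp
    have "{x \<in> space (Pi\<^sub>M {0..} (\<lambda>_. borel)). x s \<in> S} \<in> sets (Pi\<^sub>M {0..} (\<lambda>_. borel :: real measure))"
      by measurable
    from in_vimage_algebra[OF this, of "process_path Xp" "space M"]
    have "process_path Xp -` {x \<in> space (Pi\<^sub>M {0..} (\<lambda>_. borel)). x s \<in> S} \<inter> space M \<in> sets ?VX" .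
    also have "process_path Xp -` {x \<in> space (Pi\<^sub>M {0..} (\<lambda>_. borel)). x s \<in> S} \<inter> space M = Z -` S \<inter> space M"
      using s Z by (auto simp: process_path_def space_PiM)
    finally show "Z -` S \<inter> space M \<in> sets ?VX" .
  qed
  ultimately show ?thesis
    unfolding indep_var_eq using indep_set_subset[OF ind] by simp
qed

end

section \<open>The covariance as an integral of the expected value function\<close>

context switching_law
begin

text \<open>\<open>Y 0\<close> is \<open>- \<delta>\<close> almost surely and
  \<open>\<delta>\<close> squares to 1, so \<open>Y t * Y 0\<close> depends only on \<open>A\<close>
  and the path after \<open>A\<close>. Averaging the path at the independent time
  \<open>t - A\<close>, and then \<open>A\<close> over its density, leads to
  \<open>integral_tail_times_switch_mean\<close>.\<close>

lemma covariance_stationary_switch_process: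
  assumes Y: "stationary_switch_process N F f Y" and t: "0 \<le> t"
  shows "covariance N (Y t) (Y 0)
    = 1 - 2 / (\<integral>x. x \<partial>F) * (\<integral>s. indicator {0..t} s * switch_mean F s \<partial>lborel)"
proof -
  let ?\<mu> = "\<integral>x. x \<partial>F"
  obtain A B \<delta> Xp Xm where proc: "switch_process N F Xp" "switch_process N F Xm"
    and joint: "distributed N (lborel \<Otimes>\<^sub>M lborel) (\<lambda>\<omega>. (A \<omega>, B \<omega>))
          (\<lambda>(a, b). ennreal (if 0 \<le> a \<and> 0 \<le> b then f (a + b) / ?\<mu> else 0))"
    and nonneg: "AE \<omega> in N. 0 \<le> A \<omega> \<and> 0 \<le> B \<omega>"
    and \<delta> [measurable]: "\<delta> \<in> borel_measurable N"
    and \<delta>_plus: "measure N {\<omega> \<in> space N. \<delta> \<omega> = 1} = 1 / 2"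
    and \<delta>_minus: "measure N {\<omega> \<in> space N. \<delta> \<omega> = - 1} = 1 / 2"
    and indep: "stationary_components_indep N A B \<delta> Xp Xm"
    and Y_eq: "\<And>t \<omega>. \<omega> \<in> space N \<Longrightarrow> Y t \<omega> =
           (if - B \<omega> < t \<and> t < A \<omega> then - \<delta> \<omega>
            else if A \<omega> \<le> t then \<delta> \<omega> * Xp (t - A \<omega>) \<omega>
            else - \<delta> \<omega> * Xm (- (t + B \<omega>)) \<omega>)"
    using Y unfolding stationary_switch_process_def by blast
  obtain Tp where Tp: "switching_times N F Tp"
    and Xp: "\<And>t \<omega>. 0 \<le> t \<Longrightarrow> \<omega> \<in> space N \<Longrightarrow> Xp t \<omega> = (- 1) ^ switch_count Tp t \<omega>"
    using proc(1) unfolding switch_process_def by blast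
  obtain Tm where Tm: "switching_times N F Tm"
    and Xm: "\<And>t \<omega>. 0 \<le> t \<Longrightarrow> \<omega> \<in> space N \<Longrightarrow> Xm t \<omega> = (- 1) ^ switch_count Tm t \<omega>"
    using proc(2) unfolding switch_process_def by blast
  interpret P: switching_sequence F f N Tp by unfold_locales (rule Tp)
  interpret Q: switching_sequence F f N Tm by unfold_locales (rule Tm)
  have "distributed N lborel A (\<lambda>a. \<integral>\<^sup>+b. ennreal (if 0 \<le> a \<and> 0 \<le> b then f (a + b) / ?\<mu> else 0) \<partial>lborel)"
    using P.M.distr_marginal1[OF lborel.sigma_finite_measure_axioms lborel.sigma_finite_measure_axioms joint] by simp
  then have dist_A: "distributed N lborel A (\<lambda>a. ennreal (indicator {0..} a * ((1 - cdf F a) / ?\<mu>)))"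
    unfolding nn_integral_joint_density .
  have dist_B: "distributed N lborel B (\<lambda>b. \<integral>\<^sup>+a. ennreal (if 0 \<le> a \<and> 0 \<le> b then f (a + b) / ?\<mu> else 0) \<partial>lborel)"
    using P.M.distr_marginal2[OF lborel.sigma_finite_measure_axioms lborel.sigma_finite_measure_axioms joint] by simp
  have A [measurable]: "A \<in> borel_measurable N" and B [measurable]: "B \<in> borel_measurable N"
    using dist_A dist_B by (auto simp: distributed_def)
  have pos: "AE \<omega> in N. 0 < A \<omega> \<and> 0 < B \<omega>"
    using nonneg distributed_lborel_AE_neq[OF dist_A, of 0] distributed_lborel_AE_neq[OF dist_B, of 0]
    by eventually_elim auto
  have Zp [measurable]: "(\<lambda>\<omega>. (- 1) ^ switch_count Tp (s - A \<omega>) \<omega> :: real) \<in> borel_measurable N" for s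
    by (rule P.borel_measurable_switch_sign) measurable
  have Zm [measurable]: "(\<lambda>\<omega>. (- 1) ^ switch_count Tm (- (s + B \<omega>)) \<omega> :: real) \<in> borel_measurable N" for s
    by (rule Q.borel_measurable_switch_sign) measurable
  have Y_meas [measurable]: "Y s \<in> borel_measurable N" for s
  proof (subst measurable_cong)
    \<comment> \<open>The sign formulas hold for nonnegative times only; in the last branch the
      failed tests force \<open>s\<close> \<le> \<open>- B \<omega>\<close>.\<close>
    show "Y s \<omega> = (if - B \<omega> < s \<and> s < A \<omega> then - \<delta> \<omega>
            else if A \<omega> \<le> s then \<delta> \<omega> * (- 1) ^ switch_count Tp (s - A \<omega>) \<omega>
            else - \<delta> \<omega> * (- 1) ^ switch_count Tm (- (s + B \<omega>)) \<omega>)" if "\<omega> \<in> space N" for \<omega>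
      using that by (auto simp: Y_eq Xp Xm)
  qed measurable

  have \<delta>_sign: "AE \<omega> in N. \<delta> \<omega> = 1 \<or> \<delta> \<omega> = - 1"
  proof -
    have "P.M.prob ({\<omega> \<in> space N. \<delta> \<omega> = 1} \<union> {\<omega> \<in> space N. \<delta> \<omega> = - 1}) = 1"
      by (subst P.M.finite_measure_Union) (auto simp: \<delta>_plus \<delta>_minus)
    then have "AE \<omega> in N. \<omega> \<in> {\<omega> \<in> space N. \<delta> \<omega> = 1} \<union> {\<omega> \<in> space N. \<delta> \<omega> = - 1}"
      by (subst (asm) P.M.prob_eq_1) measurable
    then show ?thesis by eventually_elim auto
  qed
  \<comment> \<open>Writing \<open>- \<delta>\<close> through the indicator of
    \<open>\<delta> = 1\<close> lets the mean be read off from the probability 1/2.\<close>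
  have "(\<integral>\<omega>. Y 0 \<omega> \<partial>N) = (\<integral>\<omega>. 1 - 2 * indicator {\<omega> \<in> space N. \<delta> \<omega> = 1} \<omega> \<partial>N)"
  proof (rule integral_cong_AE)
    show "AE \<omega> in N. Y 0 \<omega> = 1 - 2 * indicator {\<omega> \<in> space N. \<delta> \<omega> = 1} \<omega>"
      using pos \<delta>_sign AE_space by eventually_elim (auto simp: Y_eq)
  qed measurable
  also have "\<dots> = 0"
    using \<delta>_plus by (subst Bochner_Integration.integral_diff) (auto simp: P.M.prob_space P.M.emeasure_eq_measure)
  finally have Y0_mean: "(\<integral>\<omega>. Y 0 \<omega> \<partial>N) = 0" .
  have int_Y0: "integrable N (Y 0)"
  proof (rule P.M.integrable_const_bound[of _ 1])
    show "AE \<omega> in N. norm (Y 0 \<omega>) \<le> 1"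
      using pos \<delta>_sign AE_space by eventually_elim (auto simp: Y_eq)
  qed measurable

  \<comment> \<open>The time elapsed at \<open>t\<close> since the first switch after the origin,
    negative while \<open>t\<close> < \<open>A\<close>.\<close>
  define \<tau> where "\<tau> \<omega> = t - A \<omega>" for \<omega>
  have \<tau> [measurable]: "\<tau> \<in> borel_measurable N"
    unfolding \<tau>_def[abs_def] by measurable
  let ?Z = "\<lambda>\<omega>. of_bool (0 \<le> \<tau> \<omega>) * (- 1) ^ switch_count Tp (\<tau> \<omega>) \<omega> :: real"
  have Z_meas [measurable]: "?Z \<in> borel_measurable N"
    using Zp[of t, folded \<tau>_def] by measurable
  \<comment> \<open>For \<open>t\<close> \<ge> 0 the branch with \<open>Xm\<close> does not occur
    almost surely, as \<open>- B\<close> is negative.\<close>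
  have prod_eq: "AE \<omega> in N. Y t \<omega> * Y 0 \<omega> = 1 - of_bool (0 \<le> \<tau> \<omega>) - ?Z \<omega>"
    using pos \<delta>_sign AE_space
  proof eventually_elim
    case (elim \<omega>)
    then have "Y 0 \<omega> = - \<delta> \<omega>" and "\<delta> \<omega> * \<delta> \<omega> = 1"
      by (auto simp: Y_eq)
    moreover have "Y t \<omega> = (if t < A \<omega> then - \<delta> \<omega> else \<delta> \<omega> * (- 1) ^ switch_count Tp (t - A \<omega>) \<omega>)"
      using elim t by (auto simp: Y_eq Xp)
    ultimately show ?case by (auto simp: \<tau>_def)
  qed
  have int_Z: "integrable N ?Z"
    by (rule P.M.integrable_const_bound[of _ 1]) auto
  have int_ind: "integrable N (\<lambda>\<omega>. of_bool (0 \<le> \<tau> \<omega>) :: real)"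
    by (rule P.M.integrable_const_bound[of _ 1]) auto
  have int_mean: "integrable N (\<lambda>\<omega>. of_bool (0 \<le> \<tau> \<omega>) * switch_mean F (\<tau> \<omega>))"
    using abs_switch_mean_le_1 by (intro P.M.integrable_const_bound[of _ 1]) auto
  have int_prod: "integrable N (\<lambda>\<omega>. Y t \<omega> * Y 0 \<omega>)"
    using integrable_cong_AE[OF _ _ prod_eq] int_Z int_ind by simp

  have Z_mean: "(\<integral>\<omega>. ?Z \<omega> \<partial>N) = (\<integral>\<omega>. of_bool (0 \<le> \<tau> \<omega>) * switch_mean F (\<tau> \<omega>) \<partial>N)"
  proof (rule P.M.expectation_at_independent_time[where Z="\<lambda>s \<omega>. (- 1) ^ switch_count Tp s \<omega>" and t=t])
    show "P.M.indep_var borel \<tau> borel (\<lambda>\<omega>. (- 1) ^ switch_count Tp s \<omega> :: real)" if "0 \<le> s" for s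
      unfolding \<tau>_def[abs_def]
      by (rule P.M.stationary_components_indep_var[OF indep _ _ _ that])
         (use that in \<open>auto simp: Xp intro!: P.borel_measurable_switch_sign\<close>)
    show "AE \<omega> in N. \<forall>s\<ge>0. \<forall>r. (\<forall>n::nat. s \<le> r n) \<longrightarrow> r \<longlonglongrightarrow> s \<longrightarrow>
        (\<lambda>n. (- 1) ^ switch_count Tp (r n) \<omega> :: real) \<longlonglongrightarrow> (- 1) ^ switch_count Tp s \<omega>"
      using P.AE_regular by eventually_elim (blast intro: P.switch_sign_right_continuous)
    show "AE \<omega> in N. \<tau> \<omega> \<le> t"
      using nonneg by eventually_elim (simp add: \<tau>_def)
  qed (auto simp: P.expectation_switch_sign continuous_on_switch_mean)

  \<comment> \<open>The mean of \<open>Y t\<close> enters only as a factor of the mean of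
    \<open>Y 0\<close>, which is 0.\<close>
  have "covariance N (Y t) (Y 0) = (\<integral>\<omega>. Y t \<omega> * Y 0 \<omega> - (\<integral>x. Y t x \<partial>N) * Y 0 \<omega> \<partial>N)"
    unfolding covariance_def Y0_mean by (simp add: algebra_simps)
  also have "\<dots> = (\<integral>\<omega>. Y t \<omega> * Y 0 \<omega> \<partial>N)"
    using int_prod int_Y0 by (simp add: Y0_mean)
  also have "\<dots> = (\<integral>\<omega>. 1 - of_bool (0 \<le> \<tau> \<omega>) - ?Z \<omega> \<partial>N)"
    using prod_eq by (intro integral_cong_AE) measurable
  also have "\<dots> = 1 - (\<integral>\<omega>. of_bool (0 \<le> \<tau> \<omega>) \<partial>N) - (\<integral>\<omega>. ?Z \<omega> \<partial>N)"
    using int_Z int_ind by (simp add: P.M.prob_space)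
  also have "\<dots> = 1 - (\<integral>\<omega>. of_bool (0 \<le> \<tau> \<omega>) + of_bool (0 \<le> \<tau> \<omega>) * switch_mean F (\<tau> \<omega>) \<partial>N)"
    unfolding Z_mean using int_ind int_mean by simp
  also have "(\<integral>\<omega>. of_bool (0 \<le> \<tau> \<omega>) + of_bool (0 \<le> \<tau> \<omega>) * switch_mean F (\<tau> \<omega>) \<partial>N)
      = (\<integral>\<omega>. of_bool (A \<omega> \<le> t) * (1 + switch_mean F (t - A \<omega>)) \<partial>N)"
    by (intro Bochner_Integration.integral_cong) (auto simp: \<tau>_def)
  \<comment> \<open>The expectation passes to the density of \<open>A\<close>; its indicator of
    \<open>{0..}\<close> and the condition \<open>a\<close> \<le> \<open>t\<close> then merge into
    the window \<open>{0..t}\<close>.\<close>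
  also have "\<dots> = (\<integral>a. (indicator {0..} a * ((1 - cdf F a) / ?\<mu>)) * (of_bool (a \<le> t) * (1 + switch_mean F (t - a))) \<partial>lborel)"
  proof (rule distributed_integral[OF dist_A, symmetric])
    fix a :: real
    show "0 \<le> indicator {0..} a * ((1 - cdf F a) / ?\<mu>)"
      using mean_nonneg cdf_bounded_prob[of a] by simp
  qed measurable
  also have "\<dots> = (\<integral>a. (indicator {0..t} a * ((1 - cdf F a) * (1 + switch_mean F (t - a)))) / ?\<mu> \<partial>lborel)"
    by (intro Bochner_Integration.integral_cong) (auto split: split_indicator)
  also have "\<dots> = 2 * (\<integral>s. indicator {0..t} s * switch_mean F s \<partial>lborel) / ?\<mu>"
    by (simp only: integral_divide_zero integral_tail_times_switch_mean)
  finally show ?thesis by simp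
qed

end

section \<open>Differentiation by the fundamental theorem of calculus\<close>

theorem theorem2:
  fixes F :: "real measure" and f :: "real \<Rightarrow> real"
    and M :: "'a measure" and X :: "real \<Rightarrow> 'a \<Rightarrow> real"
    and N :: "'b measure" and Y :: "real \<Rightarrow> 'b \<Rightarrow> real"
    and C E :: "real \<Rightarrow> real" and \<mu> :: real
  assumes "switching_time_distribution F f"
    and "integrable F (\<lambda>x. x)"
    and "switch_process M F X"
    and "stationary_switch_process N F f Y"
  defines "\<mu> \<equiv> (\<integral>x. x \<partial>F)"
    and "E \<equiv> (\<lambda>t. \<integral>\<omega>. X t \<omega> \<partial>M)"
    and "C \<equiv> (\<lambda>t. covariance N (Y t) (Y 0))"
  shows "(\<forall>t>0. (C has_real_derivative - (2 / \<mu>) * E t) (at t)) \<and>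
         (C has_real_derivative - (2 / \<mu>) * E 0) (at_right 0)"
proof -
  interpret switching_law F f by unfold_locales (rule assms(1))
  obtain T where T: "switching_times M F T"
    and X: "\<And>t \<omega>. 0 \<le> t \<Longrightarrow> \<omega> \<in> space M \<Longrightarrow> X t \<omega> = (- 1) ^ switch_count T t \<omega>"
    using assms(3) unfolding switch_process_def by blast
  interpret S: switching_sequence F f M T by unfold_locales (rule T)
  have E: "E t = switch_mean F t" if "0 \<le> t" for t
  proof -
    have "E t = (\<integral>\<omega>. (- 1) ^ switch_count T t \<omega> \<partial>M)"
      unfolding E_def using X that by (intro Bochner_Integration.integral_cong) auto
    with that show ?thesis by (simp add: S.expectation_switch_sign)
  qed
  have cont: "continuous_on {0..b} (switch_mean F)" for b
    by (rule continuous_on_subset[OF continuous_on_switch_mean]) auto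
  \<comment> \<open>The Lebesgue integral is rewritten as a gauge integral, the form in which the
    fundamental theorem is applied.\<close>
  have C: "C t = 1 - 2 / \<mu> * integral {0..t} (switch_mean F)" if "0 \<le> t" for t
    using set_borel_integral_eq_integral(2)[OF borel_integrable_atLeastAtMost'[OF cont[of t]]]
    by (simp add: C_def \<mu>_def covariance_stationary_switch_process[OF assms(4) that] set_lebesgue_integral_def)
  \<comment> \<open>The point \<open>t\<close> is interior to \<open>{0..t + 1}\<close> if positive
    and its left end if 0, so one derivative within this interval covers both claims. The interval
    stays in the half-line, where the formula for \<open>C\<close> holds.\<close>
  have deriv: "(C has_real_derivative - (2 / \<mu>) * E t) (at t within {0..t + 1})" if t: "0 \<le> t" for t
  proof (rule has_field_derivative_transform_within[where d=1])
    have "((\<lambda>s. integral {0..s} (switch_mean F)) has_real_derivative switch_mean F t) (at t within {0..t + 1})"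
      using t by (intro integral_has_real_derivative cont) simp
    from DERIV_diff[OF DERIV_const DERIV_cmult[OF this, of "2 / \<mu>"]]
    show "((\<lambda>s. 1 - 2 / \<mu> * integral {0..s} (switch_mean F)) has_real_derivative - (2 / \<mu>) * E t) (at t within {0..t + 1})"
      by (simp add: E t)
  qed (use t in \<open>auto simp: C\<close>)
  show ?thesis
  proof (intro conjI allI impI)
    fix t :: real assume "0 < t"
    then show "(C has_real_derivative - (2 / \<mu>) * E t) (at t)"
      using deriv[of t] at_within_Icc_at[of 0 t "t + 1"] by simp
  next
    show "(C has_real_derivative - (2 / \<mu>) * E 0) (at_right 0)"
      using deriv[of 0] at_within_Icc_at_right[of 0 "1::real"] by simp
  qed
qed

end
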